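(* Let $G$ be a finite simple graph with combinatorial Laplacian $L$, and let $k \ge 1$ be an integer. Then the integer $\det(1 - kL)$ is equal to the number of $k$-colored rooted even spanning forests in $G$ minus the number of $k$-colored rooted odd spanning forests in $G$.
   Context: For a finite simple graph $G$ with vertex set $V$, $|V|=n$, the combinatorial Laplacian is the $n\times n$ matrix $L = D - A$, where $A$ is the adjacency matrix and $D$ is the diagonal matrix of vertex degrees; equivalently $L = C^T C$, where $C$ is the (oriented) incidence matrix ("gradient") with rows indexed by edges and columns indexed by vertices. In $\det(1-kL)$, $1$ denotes the $n\times n$ identity matrix. A spanning forest in $G$ is a subgraph with vertex set all of $V$, whose edges are edges of $G$, and which contains no cycles; its connected components are trees, and a tree consisting of a single vertex (a "seed") is allowed. A rooted spanning forest is a spanning forest together with a choice of one vertex (the root) in each of its connected components. A $k$-colored rooted spanning forest is a rooted spanning forest together with an assignment of one of $k$ colors to each of its edges (an arbitrary assignment, with no properness condition). Two $k$-colored rooted spanning forests are counted as the same only if they have the same edges, the same roots and the same edge colors (vertices are labeled; no identification up to isomorphism). A forest is called even if it has an even number of edges (zero included), and odd if it has an odd number of edges. *)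

theory Defs
  imports "Jordan_Normal_Form.Determinant" "HOL-Library.FuncSet"
begin

text \<open>A graph is given by a vertex set and a set of edges; an edge is an unordered pair of
  distinct vertices, represented as a two-element set. This excludes loops and multiple edges.\<close>

definition finite_simple_graph :: "'a set \<Rightarrow> 'a set set \<Rightarrow> bool" where
  "finite_simple_graph V E \<longleftrightarrow> finite V \<and> (\<forall>e\<in>E. e \<subseteq> V \<and> card e = 2)"

definition degree :: "'a set set \<Rightarrow> 'a \<Rightarrow> nat" where
  "degree E v = card {e \<in> E. v \<in> e}"

text \<open>Matrices are indexed by \<open>{0..<n}\<close>, so the vertices are enumerated by a list \<open>vs\<close>;
  row and column \<open>i\<close> belong to the vertex \<open>vs ! i\<close>.\<close>

definition adjacency_matrix :: "'a list \<Rightarrow> 'a set set \<Rightarrow> int mat" where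
  "adjacency_matrix vs E = mat (length vs) (length vs)
     (\<lambda>(i, j). if {vs ! i, vs ! j} \<in> E then 1 else 0)"

definition degree_matrix :: "'a list \<Rightarrow> 'a set set \<Rightarrow> int mat" where
  "degree_matrix vs E = mat (length vs) (length vs)
     (\<lambda>(i, j). if i = j then int (degree E (vs ! i)) else 0)"

definition laplacian :: "'a list \<Rightarrow> 'a set set \<Rightarrow> int mat" where
  "laplacian vs E = degree_matrix vs E - adjacency_matrix vs E"

text \<open>A cycle is given by its distinct vertices in cyclic order, the last one being joined
  to the first.\<close>

definition is_cycle :: "'a set set \<Rightarrow> 'a list \<Rightarrow> bool" where
  "is_cycle F p \<longleftrightarrow> length p \<ge> 3 \<and> distinct p \<and>
     (\<forall>i<length p. {p ! i, p ! (Suc i mod length p)} \<in> F)"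

text \<open>A spanning subgraph contains all the vertices, so it is determined by its edge set.\<close>

definition spanning_forest :: "'a set set \<Rightarrow> 'a set set \<Rightarrow> bool" where
  "spanning_forest E F \<longleftrightarrow> F \<subseteq> E \<and> (\<nexists>p. is_cycle F p)"

definition connectivity :: "'a set \<Rightarrow> 'a set set \<Rightarrow> ('a \<times> 'a) set" where
  "connectivity V F = {(u, v). u \<in> V \<and> v \<in> V \<and> (u, v) \<in> {(x, y). {x, y} \<in> F}\<^sup>*}"

definition connected_components :: "'a set \<Rightarrow> 'a set set \<Rightarrow> 'a set set" where
  "connected_components V F = V // connectivity V F"

text \<open>The choice of one root in each component is represented by the set \<open>R\<close> of all roots.\<close>

definition rooted_spanning_forest :: "'a set \<Rightarrow> 'a set set \<Rightarrow> 'a set set \<Rightarrow> 'a set \<Rightarrow> bool" where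
  "rooted_spanning_forest V E F R \<longleftrightarrow> spanning_forest E F \<and> R \<subseteq> V \<and>
     (\<forall>C\<in>connected_components V F. \<exists>!r. r \<in> R \<and> r \<in> C)"

text \<open>The colors are \<open>{0..<k}\<close>. Colorings are extensional (\<open>undefined\<close> outside \<open>F\<close>), so that
  distinct functions are distinct colorings of \<open>F\<close>.\<close>

definition colored_rooted_spanning_forests ::
  "nat \<Rightarrow> 'a set \<Rightarrow> 'a set set \<Rightarrow> ('a set set \<times> 'a set \<times> ('a set \<Rightarrow> nat)) set" where
  "colored_rooted_spanning_forests k V E =
     {(F, R, c). rooted_spanning_forest V E F R \<and> c \<in> F \<rightarrow>\<^sub>E {0..<k}}"

definition even_colored_rooted_spanning_forests ::
  "nat \<Rightarrow> 'a set \<Rightarrow> 'a set set \<Rightarrow> ('a set set \<times> 'a set \<times> ('a set \<Rightarrow> nat)) set" where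
  "even_colored_rooted_spanning_forests k V E =
     {(F, R, c) \<in> colored_rooted_spanning_forests k V E. even (card F)}"

definition odd_colored_rooted_spanning_forests ::
  "nat \<Rightarrow> 'a set \<Rightarrow> 'a set set \<Rightarrow> ('a set set \<times> 'a set \<times> ('a set \<Rightarrow> nat)) set" where
  "odd_colored_rooted_spanning_forests k V E =
     {(F, R, c) \<in> colored_rooted_spanning_forests k V E. odd (card F)}"

end

theory Submission imports Defs begin

text \<open>With \<open>t = -k\<close>, row \<open>i\<close> of \<open>1 + t L\<close> is the sum of the unit vector \<open>e\<^sub>i\<close> and of the vectors
  \<open>t (e\<^sub>i - e\<^sub>j)\<close> over the neighbours \<open>j\<close> of \<open>i\<close>. Expanding the determinant by multilinearity in
  the rows gives a sum over the maps \<open>f\<close> that send each vertex to itself (a root) or to a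
  neighbour (its parent), weighted by a power of \<open>t\<close> and by the determinant of the matrix with rows
  \<open>e\<^sub>i\<close> or \<open>e\<^sub>i - e\<^bsub>f i\<^esub>\<close>. This determinant is 1 if every vertex reaches a fixed point of \<open>f\<close>, and
  0 otherwise. The maps of the first kind are the parent maps of the rooted spanning forests, so
  the determinant is the sum of \<open>t\<close> to the number of edges over the rooted spanning forests.\<close>

subsection \<open>Maps whose orbits reach fixed points\<close>

text \<open>On a finite set mapped to itself by \<open>f\<close>, this says that the orbit of
  \<open>x\<close> does not end in a cycle of length at least two.\<close>

definition grounded :: "('a \<Rightarrow> 'a) \<Rightarrow> 'a \<Rightarrow> bool" where
  "grounded f x \<longleftrightarrow> (\<exists>m. f ((f ^^ m) x) = (f ^^ m) x)"

text \<open>Meaningful only at grounded points; elsewhere \<open>LEAST\<close> gives an unspecified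
  value.\<close>

definition depth :: "('a \<Rightarrow> 'a) \<Rightarrow> 'a \<Rightarrow> nat" where
  "depth f x = (LEAST m. f ((f ^^ m) x) = (f ^^ m) x)"

definition root_of :: "('a \<Rightarrow> 'a) \<Rightarrow> 'a \<Rightarrow> 'a" where
  "root_of f x = (f ^^ depth f x) x"

lemma grounded_fixed: "f x = x \<Longrightarrow> grounded f x"
  unfolding grounded_def by (rule exI[of _ 0]) simp

lemma grounded_step: "grounded f (f x) \<longleftrightarrow> grounded f x"
proof
  assume "grounded f (f x)"
  then obtain m where "f ((f ^^ m) (f x)) = (f ^^ m) (f x)" unfolding grounded_def by blast
  then have "f ((f ^^ Suc m) x) = (f ^^ Suc m) x" by (simp only: funpow_Suc_right comp_apply)
  then show "grounded f x" unfolding grounded_def by blast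
next
  assume "grounded f x"
  then obtain m where "f ((f ^^ m) x) = (f ^^ m) x" unfolding grounded_def by blast
  then have "f ((f ^^ m) (f x)) = (f ^^ m) (f x)" by (simp add: funpow_swap1[symmetric])
  then show "grounded f (f x)" unfolding grounded_def by blast
qed

lemma depth_fixed: "f x = x \<Longrightarrow> depth f x = 0"
  unfolding depth_def by (rule Least_eq_0) simp

text \<open>This strict drop drives the induction on grounded points and rules out two points that
  are each other's parent.\<close>

lemma depth_step:
  assumes "grounded f x" "f x \<noteq> x"
  shows "depth f x = Suc (depth f (f x))"
proof -
  obtain m where "f ((f ^^ m) x) = (f ^^ m) x" using assms(1) unfolding grounded_def by blast
  from Least_Suc[of "\<lambda>m. f ((f ^^ m) x) = (f ^^ m) x", OF this] assms(2)
  show ?thesis unfolding depth_def by (simp add: funpow_swap1)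
qed

lemma root_fixed: "f x = x \<Longrightarrow> root_of f x = x"
  unfolding root_of_def by (simp add: depth_fixed)

lemma root_step: "grounded f x \<Longrightarrow> root_of f (f x) = root_of f x"
  by (cases "f x = x") (simp_all add: root_of_def depth_step funpow_swap1)

text \<open>Induction on \<open>depth\<close>: a property spreads from the roots to their
  descendants.\<close>

lemma grounded_induct [consumes 1, case_names fixed step]:
  assumes "grounded f x"
    and "\<And>x. f x = x \<Longrightarrow> P x"
    and "\<And>x. grounded f x \<Longrightarrow> f x \<noteq> x \<Longrightarrow> P (f x) \<Longrightarrow> P x"
  shows "P x"
  using assms(1)
proof (induction "depth f x" arbitrary: x rule: less_induct)
  case less
  show ?case
  proof (cases "f x = x")
    case False
    then show ?thesis
      using assms(3)[OF less.prems False] less depth_step[OF less.prems False] grounded_step[of f x]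
      by simp
  qed (rule assms(2))
qed

lemma fixed_root: "grounded f x \<Longrightarrow> f (root_of f x) = root_of f x"
  by (induction rule: grounded_induct) (simp_all add: root_fixed root_step)

lemma root_in:
  assumes "grounded f x" "x \<in> V" "f \<in> V \<rightarrow> V"
  shows "root_of f x \<in> V"
  using assms(1,2)
proof (induction rule: grounded_induct)
  case (step x)
  then show ?case using assms(3) root_step[of f x] by auto
qed (simp add: root_fixed)

subsection \<open>Parent maps and rooted spanning forests\<close>

definition links :: "'a set set \<Rightarrow> ('a \<times> 'a) set" where
  "links F = {(x, y). {x, y} \<in> F}"

lemma links_mono: "F \<subseteq> F' \<Longrightarrow> links F \<subseteq> links F'"
  unfolding links_def by blast

lemma sym_links: "sym (links F)"
  unfolding links_def sym_def by (simp add: insert_commute)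

definition parent_edges :: "'a set \<Rightarrow> ('a \<Rightarrow> 'a) \<Rightarrow> 'a set set" where
  "parent_edges V f = {{v, f v} | v. v \<in> V \<and> f v \<noteq> v}"

definition fixed_points :: "'a set \<Rightarrow> ('a \<Rightarrow> 'a) \<Rightarrow> 'a set" where
  "fixed_points V f = {v \<in> V. f v = v}"

lemma in_parent_edges_iff:
  "{x, y} \<in> parent_edges V f \<longleftrightarrow> x \<noteq> y \<and> (x \<in> V \<and> f x = y \<or> y \<in> V \<and> f y = x)"
  unfolding parent_edges_def by (auto simp: doubleton_eq_iff)

lemma root_path:
  assumes "grounded f x" "x \<in> V" "f \<in> V \<rightarrow> V"
  shows "(x, root_of f x) \<in> (links (parent_edges V f))\<^sup>*"
  using assms(1,2)
proof (induction rule: grounded_induct)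
  case (step x)
  have "(x, f x) \<in> links (parent_edges V f)"
    unfolding links_def using step by (auto simp: in_parent_edges_iff)
  moreover have "(f x, root_of f x) \<in> (links (parent_edges V f))\<^sup>*"
    using step assms(3) root_step[of f x] by auto
  ultimately show ?case by (rule converse_rtrancl_into_rtrancl)
qed (simp add: root_fixed)

text \<open>Every edge joins a vertex to its parent, and these share their root. Hence a component
  cannot contain two roots.\<close>

lemma root_eq:
  assumes "(x, y) \<in> (links (parent_edges V f))\<^sup>*" "\<And>v. v \<in> V \<Longrightarrow> grounded f v"
  shows "root_of f x = root_of f y"
  using assms(1)
proof induction
  case (step y z)
  then have "{y, z} \<in> parent_edges V f" by (simp add: links_def)
  then have "root_of f y = root_of f z"
    unfolding in_parent_edges_iff using assms(2) root_step[of f y] root_step[of f z] by auto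
  then show ?case using step by simp
qed simp

lemma parent_edges_no_cycle:
  assumes "\<And>v. v \<in> V \<Longrightarrow> grounded f v"
  shows "\<not> is_cycle (parent_edges V f) p"
proof
  assume cyc: "is_cycle (parent_edges V f) p"
  define l where "l = length p"
  have l: "l \<ge> 3" and dist: "distinct p"
    and e: "\<And>i. i < l \<Longrightarrow> {p ! i, p ! (Suc i mod l)} \<in> parent_edges V f"
    using cyc unfolding is_cycle_def l_def by auto
  have "finite ((\<lambda>i. depth f (p ! i)) ` {..<l})" "(\<lambda>i. depth f (p ! i)) ` {..<l} \<noteq> {}"
    using l by (auto simp: lessThan_empty_iff)
  from Max_in[OF this] obtain i where i: "i < l"
    and max: "depth f (p ! i) = Max ((\<lambda>i. depth f (p ! i)) ` {..<l})" by auto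
  have le: "depth f (p ! j) \<le> depth f (p ! i)" if "j < l" for j
    unfolding max using that by simp
  have up: "f (p ! i) = p ! j" if "{p ! i, p ! j} \<in> parent_edges V f" "j < l" for j
  proof (rule ccontr)
    assume "f (p ! i) \<noteq> p ! j"
    then have "p ! j \<in> V" "f (p ! j) = p ! i" "p ! i \<noteq> p ! j"
      using that by (auto simp: in_parent_edges_iff)
    then have "depth f (p ! j) = Suc (depth f (p ! i))"
      using depth_step[of f "p ! j"] assms by metis
    then show False using le[OF that(2)] by simp
  qed
  \<comment> \<open>Both neighbours of a deepest vertex on the cycle would be its parent.\<close>
  define h where "h = (if i = 0 then l - 1 else i - 1)"
  \<comment> \<open>\<open>h\<close> is the cyclic predecessor of \<open>i\<close>; it differs from
    the successor because \<open>l \<ge> 3\<close>.\<close>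
  have h: "h < l" "Suc h mod l = i" "Suc i mod l < l" "h \<noteq> Suc i mod l"
    using i l unfolding h_def by (auto simp: mod_Suc)
  have "f (p ! i) = p ! (Suc i mod l)" using up e[OF i] h by blast
  moreover have "f (p ! i) = p ! h" using up[of h] e[of h] h by (simp add: insert_commute)
  ultimately show False using h dist by (simp add: l_def nth_eq_iff_index_eq)
qed

section \<open>Reachability, paths and cycles in forests\<close>

lemma rooted_spanning_forest_iff:
  assumes "finite_simple_graph V E"
  shows "rooted_spanning_forest V E F R \<longleftrightarrow> spanning_forest E F \<and> R \<subseteq> V \<and>
    (\<forall>x\<in>V. \<exists>!r. r \<in> R \<and> (x, r) \<in> (links F)\<^sup>*)"
proof -
  \<comment> \<open>The class of \<open>x\<close> is the set of vertices reachable from it, which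
    turns the condition on the quotient into one on single vertices.\<close>
  have "connectivity V F `` {x} = {y \<in> V. (x, y) \<in> (links F)\<^sup>*}" if "x \<in> V" for x
    using that unfolding connectivity_def links_def by auto
  then have "connected_components V F = (\<lambda>x. {y \<in> V. (x, y) \<in> (links F)\<^sup>*}) ` V"
    unfolding connected_components_def quotient_def by auto
  then have "(\<forall>C\<in>connected_components V F. \<exists>!r. r \<in> R \<and> r \<in> C) \<longleftrightarrow>
      (\<forall>x\<in>V. \<exists>!r. r \<in> R \<and> r \<in> V \<and> (x, r) \<in> (links F)\<^sup>*)" by simp
  also have "\<dots> \<longleftrightarrow> (\<forall>x\<in>V. \<exists>!r. r \<in> R \<and> (x, r) \<in> (links F)\<^sup>*)" if "R \<subseteq> V"
  proof -
    have "r \<in> R \<and> r \<in> V \<and> Q \<longleftrightarrow> r \<in> R \<and> Q" for r Q using that by blast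
    then show ?thesis by (simp only:)
  qed
  finally show ?thesis unfolding rooted_spanning_forest_def by (cases "R \<subseteq> V") simp_all
qed

text \<open>The path is extended at its front; if the new vertex already occurs on it, everything
  before that occurrence is cut off.\<close>

lemma distinct_path:
  assumes "(x, y) \<in> (links F)\<^sup>*"
  shows "\<exists>p. p \<noteq> [] \<and> hd p = x \<and> last p = y \<and> distinct p \<and> successively (\<lambda>u v. {u, v} \<in> F) p"
  using assms
proof (induction rule: converse_rtrancl_induct)
  case base
  show ?case by (rule exI[of _ "[y]"]) simp
next
  case (step x z)
  then obtain p where p: "p \<noteq> []" "hd p = z" "last p = y" "distinct p"
    "successively (\<lambda>u v. {u, v} \<in> F) p" by blast
  show ?case
  proof (cases "x \<in> set p")
    case True
    then obtain as bs where "p = as @ x # bs" by (auto dest: split_list)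
    with p show ?thesis by (intro exI[of _ "x # bs"]) (auto simp: successively_append_iff)
  next
    case False
    with p step(1) show ?thesis
      by (intro exI[of _ "x # p"]) (cases p; auto simp: links_def)
  qed
qed

text \<open>The edge \<open>{x, y}\<close> closes a path with distinct vertices inside
  \<open>F'\<close>. That path has at least three vertices because \<open>x \<noteq> y\<close> and
  \<open>F'\<close> lacks this edge.\<close>

lemma cycle_from_chord:
  assumes "{x, y} \<in> F" "x \<noteq> y" "F' \<subseteq> F" "{x, y} \<notin> F'" "(x, y) \<in> (links F')\<^sup>*"
  shows "\<exists>p. is_cycle F p"
proof -
  obtain p where p: "p \<noteq> []" "hd p = x" "last p = y" "distinct p"
    "successively (\<lambda>u v. {u, v} \<in> F') p" using distinct_path[OF assms(5)] by blast
  have len: "length p \<ge> 3"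
  proof (rule ccontr)
    assume "\<not> length p \<ge> 3"
    then have "length p = 1 \<or> length p = 2" using p(1) by (cases "length p") auto
    then obtain u v where "p = [u] \<or> p = [u, v]" by (auto simp: length_Suc_conv numeral_2_eq_2)
    then show False using p assms(2,4) by auto
  qed
  have "{p ! i, p ! (Suc i mod length p)} \<in> F" if i: "i < length p" for i
  proof (cases "Suc i < length p")
    case True
    then show ?thesis using p(5) assms(3) by (auto simp: successively_conv_nth)
  next
    case False
    then have "Suc i = length p" using i by simp
    then have "i = length p - 1" "Suc i mod length p = 0" by simp_all
    then have "p ! i = y" "p ! (Suc i mod length p) = x"
      using p by (simp_all add: last_conv_nth hd_conv_nth)
    then show ?thesis using assms(1) by (simp add: insert_commute)
  qed
  then show ?thesis using len p(4) unfolding is_cycle_def by blast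
qed

text \<open>Fixing all points outside \<open>V\<close> makes a map determined by its values on
  \<open>V\<close>, and agrees with the index maps in the multilinear expansion of the
  determinant.\<close>

definition parent_maps :: "'a set \<Rightarrow> 'a set set \<Rightarrow> ('a \<Rightarrow> 'a) set" where
  "parent_maps V E = {f. f \<in> V \<rightarrow> V \<and> (\<forall>v. v \<notin> V \<longrightarrow> f v = v) \<and> parent_edges V f \<subseteq> E \<and>
     (\<forall>v\<in>V. grounded f v)}"

lemma parent_maps_D:
  assumes "f \<in> parent_maps V E"
  shows "f \<in> V \<rightarrow> V" "\<And>v. v \<notin> V \<Longrightarrow> f v = v" "parent_edges V f \<subseteq> E"
    "\<And>v. v \<in> V \<Longrightarrow> grounded f v"
  using assms unfolding parent_maps_def by auto

text \<open>Two vertices that yield the same edge would be each other's parent, so each would be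
  deeper than the other.\<close>

lemma card_parent_edges:
  assumes "\<And>v. v \<in> V \<Longrightarrow> grounded f v"
  shows "card (parent_edges V f) = card {v \<in> V. f v \<noteq> v}"
proof -
  have "inj_on (\<lambda>v. {v, f v}) {v \<in> V. f v \<noteq> v}"
  proof (rule inj_onI, rule ccontr)
    fix v w
    assume v: "v \<in> {v \<in> V. f v \<noteq> v}" and w: "w \<in> {v \<in> V. f v \<noteq> v}"
      and "{v, f v} = {w, f w}" "v \<noteq> w"
    then have "f v = w" "f w = v" by (auto simp: doubleton_eq_iff)
    then show False
      using depth_step[of f v] depth_step[of f w] v w assms by auto
  qed
  moreover have "parent_edges V f = (\<lambda>v. {v, f v}) ` {v \<in> V. f v \<noteq> v}"
    unfolding parent_edges_def by blast
  ultimately show ?thesis by (simp add: card_image)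
qed

text \<open>The root in the component of \<open>x\<close> is \<open>root_of f x\<close>. It is the
  only one, since \<open>root_of f\<close> is constant on components and a fixed point is its own
  root.\<close>

lemma parent_map_forest:
  assumes "finite_simple_graph V E" "f \<in> parent_maps V E"
  shows "rooted_spanning_forest V E (parent_edges V f) (fixed_points V f)"
proof -
  note f = parent_maps_D[OF assms(2)]
  have "\<exists>!r. r \<in> fixed_points V f \<and> (x, r) \<in> (links (parent_edges V f))\<^sup>*" if x: "x \<in> V" for x
  proof (rule ex1I[of _ "root_of f x"])
    show "root_of f x \<in> fixed_points V f \<and> (x, root_of f x) \<in> (links (parent_edges V f))\<^sup>*"
      using root_in[OF f(4)[OF x] x f(1)] fixed_root[OF f(4)[OF x]] root_path[OF f(4)[OF x] x f(1)]
      unfolding fixed_points_def by simp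
  next
    fix r assume "r \<in> fixed_points V f \<and> (x, r) \<in> (links (parent_edges V f))\<^sup>*"
    then show "r = root_of f x"
      using root_eq[OF _ f(4)] root_fixed[of f r] unfolding fixed_points_def by auto
  qed
  then show ?thesis
    unfolding rooted_spanning_forest_iff[OF assms(1)] spanning_forest_def
    using f(3) parent_edges_no_cycle[OF f(4)] by (auto simp: fixed_points_def)
qed

lemma parent_map_unique:
  assumes f: "f \<in> parent_maps V E" and g: "g \<in> parent_maps V E"
    and edges: "parent_edges V f = parent_edges V g"
    and fixed: "fixed_points V f = fixed_points V g"
  shows "f = g"
proof
  fix x
  note f = parent_maps_D[OF f] and g = parent_maps_D[OF g]
  show "f x = g x"
  proof (cases "x \<in> V")
    case True
    \<comment> \<open>If \<open>f x \<noteq> g x\<close>, the edge \<open>{x, g x}\<close> forces \<open>f (g x) = x\<close>, so \<open>g (g x) = x\<close> by induction.\<close>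
    have "x \<in> V \<longrightarrow> f x = g x" using g(4)[OF True]
    proof (induction rule: grounded_induct)
      case (fixed x)
      then show ?case using assms(4) unfolding fixed_points_def by auto
    next
      case (step x)
      show ?case
      proof (intro impI, rule ccontr)
        assume x: "x \<in> V" and "f x \<noteq> g x"
        have "{x, g x} \<in> parent_edges V f" unfolding edges using x step by (auto simp: in_parent_edges_iff)
        then have "f (g x) = x" using \<open>f x \<noteq> g x\<close> by (auto simp: in_parent_edges_iff)
        then have "g (g x) = x" using step.IH x g(1) by auto
        \<comment> \<open>Now \<open>x\<close> and \<open>g x\<close> are each other's parent under
          \<open>g\<close>, so each has depth one more than the other.\<close>
        then show False
          using depth_step[of g x] depth_step[of g "g x"] step(1,2) grounded_step[of g x] by auto
      qed
    qed
    then show ?thesis using True by simp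
  qed (simp add: f(2) g(2))
qed

text \<open>Orienting every tree towards its root recovers a parent map from a rooted
  forest.\<close>

lemma forest_parent_map:
  assumes G: "finite_simple_graph V E" and FR: "rooted_spanning_forest V E F R"
  obtains f where "f \<in> parent_maps V E" "parent_edges V f = F" "fixed_points V f = R"
proof -
  have FE: "F \<subseteq> E" and nocyc: "\<not> is_cycle F p" and RV: "R \<subseteq> V"
    and root: "\<And>x. x \<in> V \<Longrightarrow> \<exists>!r. r \<in> R \<and> (x, r) \<in> (links F)\<^sup>*" for p
    using FR unfolding rooted_spanning_forest_iff[OF G] spanning_forest_def by auto
  have FV: "x \<in> V \<and> y \<in> V \<and> x \<noteq> y" if "{x, y} \<in> F" for x y
  proof -
    have "{x, y} \<subseteq> V" "card {x, y} = 2"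
      using subsetD[OF FE that] G unfolding finite_simple_graph_def by blast+
    then show ?thesis by (cases "x = y") auto
  qed
  \<comment> \<open>\<open>d\<close> is the distance to \<open>R\<close> in the forest; the parent of a vertex is a neighbour closer to \<open>R\<close>.\<close>
  define d where "d x = (LEAST n. \<exists>r\<in>R. (x, r) \<in> links F ^^ n)" for x
  have closer: "\<exists>y. {x, y} \<in> F \<and> d y < d x" if "x \<in> V" "x \<notin> R" for x
  proof -
    have "\<exists>n. \<exists>r\<in>R. (x, r) \<in> links F ^^ n"
      using root[OF that(1)] rtrancl_imp_relpow by metis
    then have "\<exists>r\<in>R. (x, r) \<in> links F ^^ d x" unfolding d_def by (rule LeastI_ex)
    then obtain r where r: "r \<in> R" "(x, r) \<in> links F ^^ d x" by blast
    \<comment> \<open>Distance 0 would give \<open>r = x\<close>, against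
      \<open>x \<notin> R\<close>.\<close>
    with that obtain m where m: "d x = Suc m" by (cases "d x") auto
    then obtain y where "(x, y) \<in> links F" "(y, r) \<in> links F ^^ m"
      using r(2) relpow_Suc_D2 by metis
    moreover from this(2) have "d y \<le> m" unfolding d_def using r(1) by (intro Least_le) blast
    ultimately show ?thesis using m unfolding links_def by auto
  qed
  define f where "f x = (if x \<in> V - R then SOME y. {x, y} \<in> F \<and> d y < d x else x)" for x
  have f: "{x, f x} \<in> F" "d (f x) < d x" if "x \<in> V" "x \<notin> R" for x
    using someI_ex[OF closer[OF that]] that unfolding f_def by auto
  have f': "f x = x" if "x \<notin> V \<or> x \<in> R" for x using that unfolding f_def by auto
  have fV: "f \<in> V \<rightarrow> V"
  proof
    fix x assume "x \<in> V"
    then show "f x \<in> V" using f(1)[of x] f'[of x] FV[of x "f x"] by metis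
  qed
  have "f x \<noteq> x" if "x \<in> V" "x \<notin> R" for x using f(2)[OF that] by force
  then have fixed: "fixed_points V f = R"
    unfolding fixed_points_def using f' RV by blast
  have grd: "grounded f x" if "x \<in> V" for x
    using that
  proof (induction "d x" arbitrary: x rule: less_induct)
    case less
    show ?case
    proof (cases "x \<in> R")
      case True
      then show ?thesis by (simp add: f' grounded_fixed)
    next
      case False
      then show ?thesis using less f[of x] fV grounded_step[of f x] by auto
    qed
  qed
  have sub: "parent_edges V f \<subseteq> F"
  proof
    fix e assume "e \<in> parent_edges V f"
    then obtain v where "v \<in> V" "f v \<noteq> v" "e = {v, f v}" unfolding parent_edges_def by blast
    then show "e \<in> F" using f(1)[of v] f'[of v] by blast
  qed
  \<comment> \<open>An edge of \<open>F\<close> that \<open>f\<close> misses would close a cycle through the common root of its ends.\<close>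
  have sup: "e \<in> parent_edges V f" if e: "e \<in> F" for e
  proof (rule ccontr)
    assume notin: "e \<notin> parent_edges V f"
    have "card e = 2" using e FE G unfolding finite_simple_graph_def by auto
    then obtain x y where xy: "e = {x, y}" "x \<noteq> y" by (auto simp: card_2_iff)
    then have V: "x \<in> V" "y \<in> V" using FV e by auto
    let ?L = "links (parent_edges V f)"
    have path: "(v, root_of f v) \<in> ?L\<^sup>*" "root_of f v \<in> R" if "v \<in> V" for v
      using that root_path[OF grd that fV] root_in[OF grd that fV] fixed_root[OF grd]
      unfolding fixed[symmetric] fixed_points_def by auto
    have mono: "?L\<^sup>* \<subseteq> (links F)\<^sup>*" by (intro rtrancl_mono links_mono sub)
    have "(x, root_of f x) \<in> (links F)\<^sup>*" "(y, root_of f y) \<in> (links F)\<^sup>*"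
      using path(1) V mono by blast+
    moreover have "(x, y) \<in> links F" using e xy by (simp add: links_def)
    ultimately have "(x, root_of f x) \<in> (links F)\<^sup>*" "(x, root_of f y) \<in> (links F)\<^sup>*"
      by (blast intro: converse_rtrancl_into_rtrancl)+
    \<comment> \<open>Both roots lie in \<open>R\<close> and are reachable from \<open>x\<close> in
      \<open>F\<close>, so the uniqueness of roots identifies them.\<close>
    then have root_xy: "root_of f x = root_of f y"
      using root[OF V(1)] path(2)[OF V(1)] path(2)[OF V(2)] by blast
    have "(root_of f y, y) \<in> ?L\<^sup>*"
      by (rule symD[OF sym_rtrancl[OF sym_links] path(1)[OF V(2)]])
    with path(1)[OF V(1)] have "(x, y) \<in> ?L\<^sup>*"
      unfolding root_xy by (rule rtrancl_trans)
    with e xy sub notin have "\<exists>p. is_cycle F p"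
      by (intro cycle_from_chord[of x y F "parent_edges V f"]) simp_all
    then show False using nocyc by blast
  qed
  have eq: "parent_edges V f = F" using sub sup by blast
  have "f \<in> parent_maps V E"
    unfolding parent_maps_def mem_Collect_eq eq using fV f'(1) FE grd by simp
  then show ?thesis using eq fixed by (rule that)
qed

lemma bij_parent_maps_forests:
  assumes "finite_simple_graph V E"
  shows "bij_betw (\<lambda>f. (parent_edges V f, fixed_points V f)) (parent_maps V E)
    {(F, R). rooted_spanning_forest V E F R}"
proof (rule bij_betw_imageI)
  show "inj_on (\<lambda>f. (parent_edges V f, fixed_points V f)) (parent_maps V E)"
    by (rule inj_onI) (auto intro: parent_map_unique)
  show "(\<lambda>f. (parent_edges V f, fixed_points V f)) ` parent_maps V E =
    {(F, R). rooted_spanning_forest V E F R}"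
  proof (intro equalityI subsetI)
    fix FR assume "FR \<in> {(F, R). rooted_spanning_forest V E F R}"
    then obtain F R where FR: "FR = (F, R)" and "rooted_spanning_forest V E F R" by blast
    from forest_parent_map[OF assms this(2)]
    obtain f where "f \<in> parent_maps V E" "parent_edges V f = F" "fixed_points V f = R" .
    then show "FR \<in> (\<lambda>f. (parent_edges V f, fixed_points V f)) ` parent_maps V E"
      unfolding FR by blast
  qed (use parent_map_forest[OF assms] in auto)
qed

subsection \<open>Relabelling of vertices\<close>

text \<open>Conjugation of \<open>f\<close> by \<open>h\<close>, continued by the identity as
  \<open>parent_maps\<close> requires. It links maps on matrix indices with maps on
  vertices.\<close>

definition transport :: "('a \<Rightarrow> 'b) \<Rightarrow> 'a set \<Rightarrow> ('a \<Rightarrow> 'a) \<Rightarrow> 'b \<Rightarrow> 'b" where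
  "transport h V f w = (if w \<in> h ` V then h (f (inv_into V h w)) else w)"

lemma transport_apply: "inj_on h V \<Longrightarrow> x \<in> V \<Longrightarrow> transport h V f (h x) = h (f x)"
  unfolding transport_def by simp

lemma grounded_transport:
  assumes "inj_on h V" "f \<in> V \<rightarrow> V" "grounded f x" "x \<in> V"
  shows "grounded (transport h V f) (h x)"
  using assms(3,4)
proof (induction rule: grounded_induct)
  case (fixed x)
  then show ?case by (intro grounded_fixed) (simp add: transport_apply[OF assms(1)])
next
  case (step x)
  then have "grounded (transport h V f) (transport h V f (h x))"
    using assms(2) by (auto simp: transport_apply[OF assms(1)])
  then show ?case by (simp add: grounded_step)
qed

text \<open>The condition on \<open>E'\<close> goes in one direction only, so that the lemma serves
  both \<open>h\<close> and its inverse.\<close>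

lemma transport_in_parent_maps:
  assumes h: "inj_on h V" and f: "f \<in> parent_maps V E"
    and E': "\<And>e. e \<in> E \<Longrightarrow> e \<subseteq> V \<Longrightarrow> h ` e \<in> E'"
  shows "transport h V f \<in> parent_maps (h ` V) E'"
proof -
  note f = parent_maps_D[OF f]
  have "parent_edges (h ` V) (transport h V f) \<subseteq> E'"
  proof
    fix e assume "e \<in> parent_edges (h ` V) (transport h V f)"
    then obtain x where x: "x \<in> V" and "h (f x) \<noteq> h x" and e: "e = h ` {x, f x}"
      unfolding parent_edges_def by (auto simp: transport_apply[OF h])
    then have "{x, f x} \<in> parent_edges V f" unfolding parent_edges_def by auto
    then have "{x, f x} \<in> E" "{x, f x} \<subseteq> V" using f(1,3) x by auto
    then show "e \<in> E'" unfolding e by (rule E')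
  qed
  then show ?thesis
    unfolding parent_maps_def using f(1) grounded_transport[OF h f(1) f(4)]
    by (auto simp: transport_apply[OF h]) (simp add: transport_def)
qed

lemma transport_inverse:
  assumes "inj_on h V" "f \<in> V \<rightarrow> V" "\<And>v. v \<notin> V \<Longrightarrow> f v = v"
  shows "transport (inv_into V h) (h ` V) (transport h V f) = f"
proof
  fix v
  show "transport (inv_into V h) (h ` V) (transport h V f) v = f v"
  proof (cases "v \<in> V")
    case True
    have "inj_on (inv_into V h) (h ` V)" by (rule inj_on_inv_into) simp
    from transport_apply[OF this, of "h v"] show ?thesis
      using True assms(1,2) by (simp add: transport_apply Pi_iff)
  next
    case False
    then show ?thesis using assms(1,3) by (auto simp: transport_def[of "inv_into V h"])
  qed
qed

text \<open>The edge set on the left is the pullback of \<open>E\<close> along \<open>h\<close>,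
  restricted to subsets of \<open>V\<close>, where \<open>h\<close> is injective. Conjugation by the
  inverse of \<open>h\<close> undoes \<open>transport\<close>.\<close>

lemma bij_transport:
  assumes h: "inj_on h V"
  shows "bij_betw (transport h V) (parent_maps V {e. e \<subseteq> V \<and> h ` e \<in> E}) (parent_maps (h ` V) E)"
proof (rule bij_betw_byWitness[where f' = "transport (inv_into V h) (h ` V)"])
  let ?E = "{e. e \<subseteq> V \<and> h ` e \<in> E}" and ?h = "inv_into V h"
  have h': "inj_on ?h (h ` V)" by (rule inj_on_inv_into) simp
  have im: "?h ` h ` V = V" using h by simp
  show "\<forall>f\<in>parent_maps V ?E. transport ?h (h ` V) (transport h V f) = f"
    by (intro ballI transport_inverse[OF h] parent_maps_D(1,2))
  show "transport h V ` parent_maps V ?E \<subseteq> parent_maps (h ` V) E"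
    using transport_in_parent_maps[OF h] by auto
  have "h ` ?h ` e = e" if "e \<subseteq> h ` V" for e
    using that by (rule image_inv_into_cancel[OF refl])
  then have "?h ` e \<in> ?E" if "e \<in> E" "e \<subseteq> h ` V" for e
    using that inv_into_into[of _ h V] by (auto simp: subset_iff)
  then have maps: "transport ?h (h ` V) g \<in> parent_maps V ?E" if "g \<in> parent_maps (h ` V) E" for g
    using transport_in_parent_maps[OF h' that, of ?E] unfolding im by blast
  then show "transport ?h (h ` V) ` parent_maps (h ` V) E \<subseteq> parent_maps V ?E" by blast
  show "\<forall>g\<in>parent_maps (h ` V) E. transport h V (transport ?h (h ` V) g) = g"
  proof
    fix g assume g: "g \<in> parent_maps (h ` V) E"
    note D = parent_maps_D[OF g]
    show "transport h V (transport ?h (h ` V) g) = g"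
    proof
      fix w
      show "transport h V (transport ?h (h ` V) g) w = g w"
      proof (cases "w \<in> h ` V")
        case True
        then have "transport h V (transport ?h (h ` V) g) (h (?h w)) = h (?h (g w))"
          by (simp only: transport_apply[OF h inv_into_into] transport_apply[OF h'])
        moreover have "g w \<in> h ` V" using D(1) True by blast
        ultimately show ?thesis using True by (simp only: f_inv_into_f)
      next
        case False
        then show ?thesis using D(2) by (simp add: transport_def)
      qed
    qed
  qed
qed

lemma card_nonfixed_transport:
  assumes "inj_on h V" "f \<in> V \<rightarrow> V"
  shows "card {w \<in> h ` V. transport h V f w \<noteq> w} = card {v \<in> V. f v \<noteq> v}"
proof -
  have "{w \<in> h ` V. transport h V f w \<noteq> w} = h ` {v \<in> V. f v \<noteq> v}"
    using assms by (auto simp: transport_apply[OF assms(1)] Pi_iff inj_on_eq_iff[OF assms(1)])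
  then show ?thesis using assms(1) by (simp add: card_image inj_on_subset[OF assms(1)])
qed

subsection \<open>The determinant\<close>

text \<open>A root keeps the row of the identity matrix; the formula of the second case would give
  the zero vector at \<open>j = i\<close>.\<close>

definition parent_vec :: "nat \<Rightarrow> nat \<Rightarrow> nat \<Rightarrow> int vec" where
  "parent_vec n i j = (if j = i then unit_vec n i else unit_vec n i - unit_vec n j)"

lemma parent_vec_carrier [simp]: "parent_vec n i j \<in> carrier_vec n"
  unfolding parent_vec_def by simp

text \<open>Only the identity contributes to the Leibniz sum. A nonzero term needs
  \<open>p i\<close> to be \<open>i\<close> or \<open>f i\<close>; going outwards from the roots,
  \<open>p (f x) = f x\<close> and injectivity exclude \<open>p x = f x\<close> at a non-root
  \<open>x\<close>.\<close>

lemma det_grounded: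
  assumes f: "f \<in> {0..<n} \<rightarrow> {0..<n}" and grd: "\<And>i. i < n \<Longrightarrow> grounded f i"
  shows "det (mat\<^sub>r n n (\<lambda>i. parent_vec n i (f i))) = 1"
proof -
  let ?M = "mat\<^sub>r n n (\<lambda>i. parent_vec n i (f i))"
  have id: "p = id" if p: "p permutes {0..<n}" and nz: "(\<Prod>i = 0..<n. ?M $$ (i, p i)) \<noteq> 0" for p
  proof -
    have pn: "p i < n" if "i < n" for i using p that permutes_in_image[of p "{0..<n}" i] by auto
    have cases: "p i = i \<or> p i = f i" if i: "i < n" for i
    proof (rule ccontr)
      assume "\<not> (p i = i \<or> p i = f i)"
      moreover have "f i < n" using f i by auto
      ultimately have "?M $$ (i, p i) = 0" using i pn[OF i] by (simp add: parent_vec_def)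
      then have "(\<Prod>i = 0..<n. ?M $$ (i, p i)) = 0" using i by (intro prod_zero) auto
      then show False using nz by blast
    qed
    have "x < n \<longrightarrow> p x = x" if "grounded f x" for x
      using that
    proof (induction rule: grounded_induct)
      case (fixed x)
      then show ?case using cases[of x] by auto
    next
      case (step x)
      then show ?case using cases[of x] f inj_eq[OF permutes_inj[OF p]] by (metis PiE atLeastLessThan_iff zero_le)
    qed
    then have "p x = x" for x using grd permutes_not_in[OF p, of x] by (cases "x < n") auto
    then show ?thesis by auto
  qed
  have "det ?M = (\<Sum>p\<in>{p. p permutes {0..<n}}. signof p * (\<Prod>i = 0..<n. ?M $$ (i, p i)))"
    by (rule det_def') simp
  also have "\<dots> = (\<Sum>p\<in>{id}. signof p * (\<Prod>i = 0..<n. ?M $$ (i, p i)))"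
  proof (rule sum.mono_neutral_right)
    show "\<forall>p\<in>{p. p permutes {0..<n}} - {id}. signof p * (\<Prod>i = 0..<n. ?M $$ (i, p i)) = 0"
      using id by (metis (no_types, lifting) DiffE insertI1 mem_Collect_eq mult_zero_right)
  qed (simp_all add: finite_permutations permutes_id)
  also have "\<dots> = (\<Prod>i = 0..<n. ?M $$ (i, i))" by simp
  also have "\<dots> = 1"
    using f by (intro prod.neutral) (simp add: parent_vec_def Pi_iff)
  finally show ?thesis .
qed

lemma det_not_grounded:
  assumes f: "f \<in> {0..<n} \<rightarrow> {0..<n}" and i: "i < n" "\<not> grounded f i"
  shows "det (mat\<^sub>r n n (\<lambda>i. parent_vec n i (f i))) = 0"
proof -
  let ?M = "mat\<^sub>r n n (\<lambda>i. parent_vec n i (f i))"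
  \<comment> \<open>The indicator of the points that reach no fixed point lies in the kernel.\<close>
  define v :: "int vec" where "v = vec n (\<lambda>i. if grounded f i then 0 else 1)"
  have v: "v \<in> carrier_vec n" unfolding v_def by simp
  have "v $ i = 1" using i unfolding v_def by simp
  then have "v \<noteq> 0\<^sub>v n" using i(1) by auto
  moreover have "?M *\<^sub>v v = 0\<^sub>v n"
  proof (rule eq_vecI)
    fix j assume "j < dim_vec (0\<^sub>v n :: int vec)"
    then have j: "j < n" by simp
    then have fj: "f j < n" using f by auto
    \<comment> \<open>At a root the product is the entry of \<open>v\<close>, which is 0 there;
      otherwise it is the difference of the entries at \<open>j\<close> and \<open>f j\<close>,
      which agree because both points are grounded or neither is.\<close>
    have "parent_vec n j (f j) \<bullet> v = 0"
    proof (cases "f j = j")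
      case True
      then show ?thesis using j v by (simp add: parent_vec_def v_def grounded_fixed)
    next
      case False
      then show ?thesis using j fj v
        by (simp add: parent_vec_def minus_scalar_prod_distrib[of _ n]) (simp add: v_def grounded_step)
    qed
    then show "(?M *\<^sub>v v) $ j = 0\<^sub>v n $ j" using j by (simp add: carrier_vecD[OF parent_vec_carrier])
  qed simp
  ultimately show ?thesis
    using v det_0_iff_vec_prod_zero[of ?M n] by auto
qed

section \<open>Multilinear expansion of the Laplacian determinant\<close>

lemma degree_conv_card:
  assumes G: "finite_simple_graph (set vs) E" and vs: "distinct vs" and i: "i < length vs"
  shows "degree E (vs ! i) = card {j. j < length vs \<and> {vs ! i, vs ! j} \<in> E}"
proof -
  let ?J = "{j. j < length vs \<and> {vs ! i, vs ! j} \<in> E}"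
  have inj: "inj_on (\<lambda>j. {vs ! i, vs ! j}) ?J"
    using vs by (auto intro!: inj_onI simp: doubleton_eq_iff nth_eq_iff_index_eq)
  have im: "(\<lambda>j. {vs ! i, vs ! j}) ` ?J = {e \<in> E. vs ! i \<in> e}"
  proof (intro equalityI subsetI)
    fix e assume e: "e \<in> {e \<in> E. vs ! i \<in> e}"
    then have "e \<subseteq> set vs" "card e = 2" using G unfolding finite_simple_graph_def by auto
    with e obtain v where v: "e = {vs ! i, v}" "v \<in> set vs" by (auto simp: card_2_iff)
    then obtain j where "j < length vs" "v = vs ! j" by (auto simp: in_set_conv_nth)
    then show "e \<in> (\<lambda>j. {vs ! i, vs ! j}) ` ?J" using v e by auto
  qed auto
  show ?thesis unfolding degree_def im[symmetric] by (rule card_image[OF inj])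
qed

text \<open>The coefficient of \<open>parent_vec n i j\<close> in row \<open>i\<close>. The value 0
  at non-neighbours discards maps that leave the graph.\<close>

definition parent_weight :: "int \<Rightarrow> 'a list \<Rightarrow> 'a set set \<Rightarrow> nat \<Rightarrow> nat \<Rightarrow> int" where
  "parent_weight t vs E i j = (if j = i then 1 else if {vs ! i, vs ! j} \<in> E then t else 0)"

text \<open>The value is the diagonal entry of \<open>1 + t L\<close> at \<open>i\<close>.\<close>

lemma sum_parent_weight:
  assumes G: "finite_simple_graph (set vs) E" and vs: "distinct vs" and i: "i < length vs"
  shows "(\<Sum>j = 0..<length vs. parent_weight t vs E i j) = 1 + t * int (degree E (vs ! i))"
proof -
  have noloop: "{v} \<notin> E" for v using G unfolding finite_simple_graph_def by fastforce
  \<comment> \<open>The nested cases split into a sum because at \<open>j = i\<close> there is no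
    loop to count.\<close>
  have "(\<Sum>j = 0..<length vs. parent_weight t vs E i j) =
    (\<Sum>j = 0..<length vs. (if j = i then 1 else 0) + (if {vs ! i, vs ! j} \<in> E then t else 0))"
    using noloop by (intro sum.cong) (auto simp: parent_weight_def)
  also have "\<dots> = 1 + (\<Sum>j\<in>{0..<length vs}. if {vs ! i, vs ! j} \<in> E then t else 0)"
    using i by (simp add: sum.distrib)
  also have "(\<Sum>j\<in>{0..<length vs}. if {vs ! i, vs ! j} \<in> E then t else 0) =
      t * int (card ({0..<length vs} \<inter> {j. {vs ! i, vs ! j} \<in> E}))"
    by (subst sum.If_cases) auto
  also have "{0..<length vs} \<inter> {j. {vs ! i, vs ! j} \<in> E} = {j. j < length vs \<and> {vs ! i, vs ! j} \<in> E}"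
    by auto
  finally show ?thesis unfolding degree_conv_card[OF assms] .
qed

text \<open>All vectors \<open>parent_vec n i j\<close> have entry 1 in column \<open>i\<close>, so
  the weights add up on the diagonal; in a column \<open>l\<close> different from \<open>i\<close>
  only \<open>j = l\<close> contributes, with sign -1.\<close>

lemma laplacian_rows:
  assumes G: "finite_simple_graph (set vs) E" and vs: "distinct vs" and n: "n = length vs"
  shows "1\<^sub>m n + t \<cdot>\<^sub>m laplacian vs E = mat\<^sub>r n n (\<lambda>i. finsum_vec TYPE(int) n
    (\<lambda>j. parent_weight t vs E i j \<cdot>\<^sub>v parent_vec n i j) {0..<n})" (is "?A = ?B")
proof (rule eq_matI)
  fix i l assume "i < dim_row ?B" "l < dim_col ?B"
  then have i: "i < n" and l: "l < n" by auto
  let ?c = "parent_weight t vs E i"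
  have noloop: "{v} \<notin> E" for v using G unfolding finite_simple_graph_def by fastforce
  have "?B $$ (i, l) = (\<Sum>j = 0..<n. (?c j \<cdot>\<^sub>v parent_vec n i j) $ l)"
    using i l by (simp add: index_finsum_vec)
  also have "\<dots> = (\<Sum>j = 0..<n. (if l = i then ?c j else 0) - (if l = j then (if l = i then 0 else ?c l) else 0))"
    using i l by (intro sum.cong) (auto simp: parent_vec_def)
  also have "\<dots> = (if l = i then \<Sum>j = 0..<n. ?c j else - ?c l)"
    using l by (simp add: sum_subtractf)
  also have "\<dots> = ?A $$ (i, l)"
    using i l noloop n sum_parent_weight[OF G vs, of i t]
    by (auto simp: laplacian_def degree_matrix_def adjacency_matrix_def parent_weight_def)
  finally show "?A $$ (i, l) = ?B $$ (i, l)" ..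
qed (simp_all add: laplacian_def degree_matrix_def adjacency_matrix_def n)

lemma det_laplacian_parent_maps:
  assumes G: "finite_simple_graph (set vs) E" and vs: "distinct vs" and n: "n = length vs"
  shows "det (1\<^sub>m n + t \<cdot>\<^sub>m laplacian vs E) =
    (\<Sum>f\<in>parent_maps {0..<n} {e. e \<subseteq> {0..<n} \<and> (!) vs ` e \<in> E}. t ^ card {i \<in> {0..<n}. f i \<noteq> i})"
proof -
  let ?S = "{f. (\<forall>i\<in>{0..<n}. f i \<in> {0..<n}) \<and> (\<forall>i. i \<notin> {0..<n} \<longrightarrow> f i = i)}"
  let ?P = "parent_maps {0..<n} {e. e \<subseteq> {0..<n} \<and> (!) vs ` e \<in> E}"
  let ?c = "parent_weight t vs E"
  let ?d = "\<lambda>f. det (mat\<^sub>r n n (\<lambda>i. parent_vec n i (f i)))"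
  have "det (1\<^sub>m n + t \<cdot>\<^sub>m laplacian vs E) =
      (\<Sum>f\<in>?S. det (mat\<^sub>r n n (\<lambda>i. ?c i (f i) \<cdot>\<^sub>v parent_vec n i (f i))))"
    unfolding laplacian_rows[OF assms] by (rule det_linear_rows_sum) auto
  also have "\<dots> = (\<Sum>f\<in>?S. (\<Prod>i = 0..<n. ?c i (f i)) * ?d f)"
    by (intro sum.cong refl det_rows_mul) auto
  also have "\<dots> = (\<Sum>f\<in>?P. (\<Prod>i = 0..<n. ?c i (f i)) * ?d f)"
  proof (rule sum.mono_neutral_right)
    show "finite ?S" by (rule finite_bounded_functions) simp_all
    show "?P \<subseteq> ?S" unfolding parent_maps_def by auto
    \<comment> \<open>A discarded map either has a point that is not grounded, and the determinant
      vanishes, or uses a non-edge, and the product of weights vanishes.\<close>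
    show "\<forall>f\<in>?S - ?P. (\<Prod>i = 0..<n. ?c i (f i)) * ?d f = 0"
    proof
      fix f assume f: "f \<in> ?S - ?P"
      then have fn: "f \<in> {0..<n} \<rightarrow> {0..<n}" by auto
      show "(\<Prod>i = 0..<n. ?c i (f i)) * ?d f = 0"
      proof (cases "\<forall>i<n. grounded f i")
        case True
        then obtain e where e: "e \<in> parent_edges {0..<n} f" "\<not> (e \<subseteq> {0..<n} \<and> (!) vs ` e \<in> E)"
          using f fn unfolding parent_maps_def by auto
        then obtain i where "i < n" "f i \<noteq> i" "e = {i, f i}" unfolding parent_edges_def by auto
        with e(2) fn have "i \<in> {0..<n}" "?c i (f i) = 0" by (auto simp: parent_weight_def)
        then have "(\<Prod>i = 0..<n. ?c i (f i)) = 0" by (intro prod_zero) auto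
        then show ?thesis by simp
      qed (use det_not_grounded[OF fn] in auto)
    qed
  qed
  also have "\<dots> = (\<Sum>f\<in>?P. t ^ card {i \<in> {0..<n}. f i \<noteq> i})"
  proof (rule sum.cong[OF refl])
    fix f assume f: "f \<in> ?P"
    note D = parent_maps_D[OF f]
    have "(\<Prod>i = 0..<n. ?c i (f i)) = (\<Prod>i = 0..<n. if f i \<noteq> i then t else 1)"
    proof (rule prod.cong[OF refl])
      fix i assume "i \<in> {0..<n}"
      then have "{vs ! i, vs ! f i} \<in> E" if "f i \<noteq> i"
        using subsetD[OF D(3), of "{i, f i}"] that unfolding parent_edges_def by auto
      then show "?c i (f i) = (if f i \<noteq> i then t else 1)" by (simp add: parent_weight_def)
    qed
    also have "\<dots> = t ^ card {i \<in> {0..<n}. f i \<noteq> i}"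
      by (subst prod.If_cases) (simp_all add: Int_def)
    finally show "(\<Prod>i = 0..<n. ?c i (f i)) * ?d f = t ^ card {i \<in> {0..<n}. f i \<noteq> i}"
      using det_grounded[OF D(1)] D(4) by simp
  qed
  finally show ?thesis .
qed

text \<open>A weighted matrix forest theorem: the enumeration \<open>vs\<close> carries index maps
  to parent maps on \<open>V\<close>, and these correspond to rooted forests with as many edges as
  non-fixed vertices.\<close>

lemma det_laplacian_forests:
  assumes G: "finite_simple_graph V E" and vs: "distinct vs" and V: "set vs = V"
  shows "det (1\<^sub>m (card V) + t \<cdot>\<^sub>m laplacian vs E) =
    (\<Sum>(F, R)\<in>{(F, R). rooted_spanning_forest V E F R}. t ^ card F)"
proof -
  define n where "n = length vs"
  define h where "h = (!) vs"
  have card: "card V = n" using distinct_card[OF vs] V n_def by simp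
  have h: "inj_on h {0..<n}" unfolding h_def n_def using vs by (auto intro: inj_on_nth)
  have im: "h ` {0..<n} = V" unfolding h_def n_def using V by (auto simp: set_conv_nth)
  have "det (1\<^sub>m (card V) + t \<cdot>\<^sub>m laplacian vs E) =
    (\<Sum>f\<in>parent_maps {0..<n} {e. e \<subseteq> {0..<n} \<and> h ` e \<in> E}. t ^ card {i \<in> {0..<n}. f i \<noteq> i})"
    unfolding card h_def using det_laplacian_parent_maps[OF _ vs n_def] G V by simp
  also have "\<dots> = (\<Sum>f\<in>parent_maps {0..<n} {e. e \<subseteq> {0..<n} \<and> h ` e \<in> E}.
      t ^ card {v \<in> V. transport h {0..<n} f v \<noteq> v})"
    by (intro sum.cong refl) (simp only: card_nonfixed_transport[OF h parent_maps_D(1), unfolded im])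
  also have "\<dots> = (\<Sum>f\<in>parent_maps V E. t ^ card {v \<in> V. f v \<noteq> v})"
    using bij_transport[OF h, of E] unfolding im by (rule sum.reindex_bij_betw)
  also have "\<dots> = (\<Sum>f\<in>parent_maps V E. case (parent_edges V f, fixed_points V f) of (F, R) \<Rightarrow> t ^ card F)"
    by (intro sum.cong refl) (simp add: card_parent_edges parent_maps_D(4))
  also have "\<dots> = (\<Sum>(F, R)\<in>{(F, R). rooted_spanning_forest V E F R}. t ^ card F)"
    by (rule sum.reindex_bij_betw[OF bij_parent_maps_forests[OF G]])
  finally show ?thesis .
qed

text \<open>The triples form a dependent sum over the pairs \<open>(F, R)\<close>, with
  \<open>k ^ card F\<close> colorings in each fibre. The predicate \<open>P\<close> stands for
  either parity.\<close>

lemma card_colored_forests: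
  assumes G: "finite_simple_graph V E"
  shows "card {(F, R, c) \<in> colored_rooted_spanning_forests k V E. P F} =
    (\<Sum>(F, R)\<in>{(F, R). rooted_spanning_forest V E F R \<and> P F}. k ^ card F)"
proof -
  let ?A = "{(F, R). rooted_spanning_forest V E F R \<and> P F}"
  let ?B = "\<lambda>(F, R). F \<rightarrow>\<^sub>E {0..<k}"
  have "E \<subseteq> Pow V" "finite V" using G unfolding finite_simple_graph_def by auto
  then have E: "finite E" by (meson finite_Pow_iff finite_subset)
  have FE: "F \<subseteq> E" "R \<subseteq> V" if "(F, R) \<in> ?A" for F R
    using that unfolding rooted_spanning_forest_def spanning_forest_def by auto
  have F: "finite F" if "(F, R) \<in> ?A" for F R using FE(1)[OF that] E by (rule finite_subset)
  have "?A \<subseteq> Pow E \<times> Pow V" using FE by blast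
  then have A: "finite ?A" using E \<open>finite V\<close> by (meson finite_Pow_iff finite_SigmaI finite_subset)
  have "{(F, R, c) \<in> colored_rooted_spanning_forests k V E. P F} =
      (\<lambda>((F, R), c). (F, R, c)) ` Sigma ?A ?B"
    unfolding colored_rooted_spanning_forests_def by (auto simp: image_iff)
  moreover have "inj_on (\<lambda>((F, R), c). (F, R, c)) (Sigma ?A ?B)" by (auto intro!: inj_onI)
  ultimately have "card {(F, R, c) \<in> colored_rooted_spanning_forests k V E. P F} = card (Sigma ?A ?B)"
    by (simp only: card_image)
  also have "\<dots> = (\<Sum>x\<in>?A. card (?B x))"
    using A F by (intro card_SigmaI) (auto intro!: finite_PiE)
  also have "\<dots> = (\<Sum>(F, R)\<in>?A. k ^ card F)"
    using F by (intro sum.cong refl) (auto simp: card_PiE)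
  finally show ?thesis .
qed

theorem theorem3:
  fixes V :: "'a set" and E :: "'a set set" and vs :: "'a list" and k :: nat
  assumes "finite_simple_graph V E"
    and "distinct vs" and "set vs = V"
    and "k \<ge> 1"
  shows "det (1\<^sub>m (card V) - int k \<cdot>\<^sub>m laplacian vs E) =
    int (card (even_colored_rooted_spanning_forests k V E)) -
    int (card (odd_colored_rooted_spanning_forests k V E))"
proof -
  let ?A = "\<lambda>P. {(F, R). rooted_spanning_forest V E F R \<and> P F}"
  have "finite V" and "E \<subseteq> Pow V" using assms(1) unfolding finite_simple_graph_def by auto
  then have "finite (Pow E \<times> Pow V)" by (meson finite_Pow_iff finite_SigmaI finite_subset)
  moreover have "?A P \<subseteq> Pow E \<times> Pow V" for P
    unfolding rooted_spanning_forest_def spanning_forest_def by auto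
  ultimately have fin: "finite (?A P)" for P by (rule rev_finite_subset)
  have L: "laplacian vs E \<in> carrier_mat (card V) (card V)"
    using distinct_card[OF assms(2)] assms(3)
    unfolding laplacian_def degree_matrix_def adjacency_matrix_def by (simp add: carrier_matI)
  \<comment> \<open>This brings the matrix into the form \<open>1 + t L\<close> with
    \<open>t = - int k\<close>.\<close>
  have "1\<^sub>m (card V) - int k \<cdot>\<^sub>m laplacian vs E = 1\<^sub>m (card V) + (- int k) \<cdot>\<^sub>m laplacian vs E"
    using L by (intro eq_matI) auto
  then have "det (1\<^sub>m (card V) - int k \<cdot>\<^sub>m laplacian vs E) =
      (\<Sum>(F, R)\<in>{(F, R). rooted_spanning_forest V E F R}. (- int k) ^ card F)"
    by (simp only: det_laplacian_forests[OF assms(1-3)])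
  also have "{(F, R). rooted_spanning_forest V E F R} = ?A (\<lambda>F. even (card F)) \<union> ?A (\<lambda>F. odd (card F))"
    by blast
  also have "(\<Sum>(F, R)\<in>\<dots>. (- int k) ^ card F) =
      (\<Sum>(F, R)\<in>?A (\<lambda>F. even (card F)). (- int k) ^ card F) +
      (\<Sum>(F, R)\<in>?A (\<lambda>F. odd (card F)). (- int k) ^ card F)"
    by (rule sum.union_disjoint[OF fin fin]) blast
  \<comment> \<open>For an even exponent the sign of \<open>- int k\<close> disappears and the power
    counts colorings; for an odd exponent it comes out as a factor -1.\<close>
  also have "(\<Sum>(F, R)\<in>?A (\<lambda>F. even (card F)). (- int k) ^ card F) =
      int (card (even_colored_rooted_spanning_forests k V E))"
    unfolding even_colored_rooted_spanning_forests_def card_colored_forests[OF assms(1)] of_nat_sum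
    by (rule sum.cong) auto
  also have "(\<Sum>(F, R)\<in>?A (\<lambda>F. odd (card F)). (- int k) ^ card F) =
      - int (card (odd_colored_rooted_spanning_forests k V E))"
    unfolding odd_colored_rooted_spanning_forests_def card_colored_forests[OF assms(1)] of_nat_sum
      sum_negf[symmetric]
    by (rule sum.cong) auto
  finally show ?thesis by simp
qed

end
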